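(* Let $N_\alpha$ and $N_\beta$ be independent homogeneous Poisson processes with rates $\lambda_\alpha>0$ and $\lambda_\beta>0$ respectively. For an integer $k\ge1$ let $T_k=\inf\{s: N_\alpha(N_\beta(s))=k\}$. Then the (possibly defective) law of $T_k$ on $(0,\infty)$ is given by $$\Pr\{T_k\in \mathrm ds\}=\mathrm ds\;\lambda_\beta e^{-\lambda_\alpha}\frac{\lambda_\alpha^k}{k!}e^{-\lambda_\beta s}\sum_{j=0}^\infty e^{-\lambda_\alpha j}\left[(j+1)^k-j^k\right]\frac{(\lambda_\beta s)^j}{j!},\qquad s>0.$$
   Context: Poisson processes start at $0$ at time $0$ and have right-continuous paths. Convention: $\inf\emptyset=+\infty$. The displayed formula means that for every Borel set $A\subset(0,\infty)$, $\Pr\{T_k\in A\}$ is the integral over $A$ of the displayed density. *)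

theory Defs
  imports "HOL-Probability.Probability"
begin

text \<open>
  Only times \<open>t \<ge> 0\<close> are constrained. The increments are taken in \<^typ>\<open>int\<close> because subtraction on
  \<^typ>\<open>nat\<close> truncates. Paths are right-continuous for the discrete topology of \<^typ>\<open>nat\<close>; that they
  are almost surely nondecreasing is a consequence of the assumptions.
\<close>

locale poisson_process = prob_space M
  for M :: "'a measure" +
  fixes rate :: real and N :: "real \<Rightarrow> 'a \<Rightarrow> nat"
  assumes rate_pos: "0 < rate"
    and measurable_N: "\<And>t. 0 \<le> t \<Longrightarrow> random_variable (count_space UNIV) (N t)"
    and start_zero: "\<And>\<omega>. \<omega> \<in> space M \<Longrightarrow> N 0 \<omega> = 0"
    and right_continuous:
      "\<And>\<omega> t. \<omega> \<in> space M \<Longrightarrow> 0 \<le> t \<Longrightarrow> continuous (at_right t) (\<lambda>u. N u \<omega>)"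
    and indep_increments:
      "\<And>(t :: nat \<Rightarrow> real) n. 0 \<le> t 0 \<Longrightarrow> (\<And>i. i < n \<Longrightarrow> t i < t (Suc i)) \<Longrightarrow>
        indep_vars (\<lambda>_. count_space UNIV)
          (\<lambda>i \<omega>. int (N (t (Suc i)) \<omega>) - int (N (t i) \<omega>)) {..<n}"
    and poisson_increments:
      "\<And>s t. 0 \<le> s \<Longrightarrow> s < t \<Longrightarrow>
        distr M (count_space UNIV) (\<lambda>\<omega>. int (N t \<omega>) - int (N s \<omega>)) =
          measure_pmf (map_pmf int (poisson_pmf (rate * (t - s))))"

text \<open>
  Independence of two processes as independence of the random paths, on the product
  \<open>\<sigma>\<close>-algebra over the time set \<open>[0, \<infinity>)\<close>.
\<close>

definition indep_processes ::
    "'a measure \<Rightarrow> (real \<Rightarrow> 'a \<Rightarrow> nat) \<Rightarrow> (real \<Rightarrow> 'a \<Rightarrow> nat) \<Rightarrow> bool" where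
  "indep_processes M X Y \<longleftrightarrow>
    prob_space.indep_var M
      (Pi\<^sub>M {0..} (\<lambda>_. count_space UNIV)) (\<lambda>\<omega>. \<lambda>t\<in>{0..}. X t \<omega>)
      (Pi\<^sub>M {0..} (\<lambda>_. count_space UNIV)) (\<lambda>\<omega>. \<lambda>t\<in>{0..}. Y t \<omega>)"

text \<open>The value is \<open>\<infinity>\<close>, the infimum of the empty set in \<^typ>\<open>ereal\<close>, if \<open>k\<close> is never hit.\<close>

definition hitting_time :: "(real \<Rightarrow> 'a \<Rightarrow> nat) \<Rightarrow> nat \<Rightarrow> 'a \<Rightarrow> ereal" where
  "hitting_time X k \<omega> = Inf (ereal ` {s. 0 \<le> s \<and> X s \<omega> = k})"

end

theory Submission
  imports Defs
begin

text \<open>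
  Almost surely a Poisson path is nondecreasing and takes every value below its current one, so for
  fixed \<open>t\<close> the event \<open>T\<^sub>k \<le> t\<close> coincides up to a null set with the event that the random walk
  \<open>N\<^sub>\<alpha>(0), N\<^sub>\<alpha>(1), \<dots>\<close> first reaches \<open>k\<close> at some step \<open>n + 1 \<le> N\<^sub>\<beta>(t)\<close>. The walk does so at
  step \<open>n + 1\<close> with probability \<open>P(N\<^sub>\<alpha>(n+1) = k) - P(N\<^sub>\<alpha>(n) = N\<^sub>\<alpha>(n+1) = k)\<close>, while
  \<open>P(N\<^sub>\<beta>(t) > n)\<close> is an Erlang distribution function. By independence the law of \<open>T\<^sub>k\<close> is the
  corresponding mixture of Erlang laws.
\<close>

section \<open>Hitting times of right-continuous paths with discrete values\<close>

text \<open>A path that hits \<open>k\<close> keeps that value for a short while, so the hit can be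
  moved to a rational time still before \<open>a\<close>. The countable form is what makes
  \<open>T\<close> measurable.\<close>

lemma hitting_time_less_iff:
  assumes rc: "\<And>t. 0 \<le> t \<Longrightarrow> eventually (\<lambda>u. X u \<omega> = X t \<omega>) (at_right t)"
  shows "hitting_time X k \<omega> < a \<longleftrightarrow> (\<exists>q\<in>\<rat>. 0 \<le> q \<and> ereal q < a \<and> X q \<omega> = k)"
proof
  assume "hitting_time X k \<omega> < a"
  then obtain s where s: "0 \<le> s" "X s \<omega> = k" "ereal s < a"
    unfolding hitting_time_def Inf_less_iff by auto
  \<comment> \<open>A real bound \<open>c\<close> is needed to pick a rational below
    \<open>a\<close>; when \<open>a\<close> is \<infinity>, \<open>s + 1\<close> serves.\<close>
  obtain c where c: "ereal s < ereal c" "ereal c \<le> a"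
  proof (cases a)
    case (real r) with s that[of r] show ?thesis by auto
  next
    case PInf with that[of "s + 1"] show ?thesis by auto
  qed (use s in auto)
  obtain b where b: "s < b" "\<And>u. s < u \<Longrightarrow> u < b \<Longrightarrow> X u \<omega> = X s \<omega>"
    using rc[OF s(1)] unfolding eventually_at_right_field by auto
  obtain q where q: "q \<in> \<rat>" "s < q" "q < min b c"
    using Rats_dense_in_real[of s "min b c"] b c by auto
  moreover have "ereal q < a" using q c(2) by (metis less_ereal.simps(1) less_le_trans min_less_iff_conj)
  ultimately show "\<exists>q\<in>\<rat>. 0 \<le> q \<and> ereal q < a \<and> X q \<omega> = k"
    using b s by (intro bexI[of _ q]) auto
next
  assume "\<exists>q\<in>\<rat>. 0 \<le> q \<and> ereal q < a \<and> X q \<omega> = k"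
  then show "hitting_time X k \<omega> < a"
    unfolding hitting_time_def Inf_less_iff by auto
qed

lemma hitting_time_nonneg: "0 \<le> hitting_time X k \<omega>"
  unfolding hitting_time_def by (intro Inf_greatest) auto

text \<open>Right continuity makes the infimum attained, so the case of equality adds just the time
  \<open>t\<close> itself. Keeping the other times rational allows null sets to be discarded one
  time at a time later.\<close>

lemma hitting_time_le_iff:
  assumes rc: "\<And>t. 0 \<le> t \<Longrightarrow> eventually (\<lambda>u. X u \<omega> = X t \<omega>) (at_right t)"
    and t: "0 \<le> t"
  shows "hitting_time X k \<omega> \<le> ereal t \<longleftrightarrow> X t \<omega> = k \<or> (\<exists>q\<in>\<rat>. 0 \<le> q \<and> q < t \<and> X q \<omega> = k)"
proof
  assume le: "hitting_time X k \<omega> \<le> ereal t"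
  show "X t \<omega> = k \<or> (\<exists>q\<in>\<rat>. 0 \<le> q \<and> q < t \<and> X q \<omega> = k)"
  proof (cases "hitting_time X k \<omega> < ereal t")
    case True
    then show ?thesis using hitting_time_less_iff[of X \<omega> k "ereal t"] rc by auto
  next
    case False
    with le have eq: "hitting_time X k \<omega> = ereal t" by auto
    obtain b where b: "t < b" "\<And>u. t < u \<Longrightarrow> u < b \<Longrightarrow> X u \<omega> = X t \<omega>"
      using rc[OF t] unfolding eventually_at_right_field by auto
    \<comment> \<open>Some hit \<open>s\<close> lies before \<open>b\<close>, and none lies before
      the infimum \<open>t\<close>; the path is constant on [t, b), so it already equals
      \<open>k\<close> at \<open>t\<close>.\<close>
    have "hitting_time X k \<omega> < ereal b" using eq b by simp
    then obtain s where s: "0 \<le> s" "X s \<omega> = k" "s < b"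
      unfolding hitting_time_def Inf_less_iff by auto
    have "hitting_time X k \<omega> \<le> ereal s"
      unfolding hitting_time_def using s by (intro Inf_lower) auto
    with eq have "t \<le> s" by simp
    with b(2)[of s] s show ?thesis by (cases "s = t") auto
  qed
next
  assume "X t \<omega> = k \<or> (\<exists>q\<in>\<rat>. 0 \<le> q \<and> q < t \<and> X q \<omega> = k)"
  then obtain s where s: "0 \<le> s" "s \<le> t" "X s \<omega> = k" using t by (auto intro: less_imp_le)
  have "hitting_time X k \<omega> \<le> ereal s"
    unfolding hitting_time_def using s by (intro Inf_lower) auto
  then show "hitting_time X k \<omega> \<le> ereal t" using s by (meson ereal_less_eq(3) order_trans)
qed

section \<open>Path regularity of a single Poisson process\<close>

context poisson_process
begin

lemma eventually_constant:
  assumes "\<omega> \<in> space M" "0 \<le> t"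
  shows "eventually (\<lambda>u. N u \<omega> = N t \<omega>) (at_right t)"
proof -
  have "((\<lambda>u. N u \<omega>) \<longlongrightarrow> N t \<omega>) (at_right t)"
    using right_continuous[OF assms] by (simp add: continuous_within)
  then show ?thesis by (simp add: tendsto_discrete)
qed

lemma measurable_increment:
  assumes "0 \<le> s" "s < t"
  shows "(\<lambda>\<omega>. int (N t \<omega>) - int (N s \<omega>)) \<in> M \<rightarrow>\<^sub>M count_space UNIV"
proof -
  have [measurable]: "N s \<in> M \<rightarrow>\<^sub>M count_space UNIV" "N t \<in> M \<rightarrow>\<^sub>M count_space UNIV"
    using assms by (auto intro: measurable_N)
  show ?thesis by measurable
qed

lemma measure_increment:
  assumes "0 \<le> s" "s < t"
  shows "prob {\<omega> \<in> space M. P (int (N t \<omega>) - int (N s \<omega>))} =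
    measure_pmf.prob (poisson_pmf (rate * (t - s))) {n. P (int n)}"
proof -
  have "prob {\<omega> \<in> space M. P (int (N t \<omega>) - int (N s \<omega>))} =
    measure (distr M (count_space UNIV) (\<lambda>\<omega>. int (N t \<omega>) - int (N s \<omega>))) {x. P x}"
    by (subst measure_distr[OF measurable_increment[OF assms]])
      (auto intro!: arg_cong[where f = prob])
  also have "\<dots> = measure_pmf.prob (poisson_pmf (rate * (t - s))) {n. P (int n)}"
    unfolding poisson_increments[OF assms] by (simp add: vimage_def)
  finally show ?thesis .
qed

lemma measure_N:
  assumes "0 < t"
  shows "prob {\<omega> \<in> space M. P (N t \<omega>)} = measure_pmf.prob (poisson_pmf (rate * t)) {n. P n}"
proof -
  have "{\<omega> \<in> space M. P (N t \<omega>)} = {\<omega> \<in> space M. P (nat (int (N t \<omega>) - int (N 0 \<omega>)))}"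
    using start_zero by auto
  then show ?thesis using measure_increment[of 0 t "\<lambda>x. P (nat x)"] assms by simp
qed

text \<open>The Poisson law of the integer increment is carried by the nonnegative integers. The
  null set depends on \<open>s\<close> and \<open>t\<close>.\<close>

lemma AE_mono:
  assumes "0 \<le> s" "s \<le> t"
  shows "AE \<omega> in M. N s \<omega> \<le> N t \<omega>"
proof (cases "s = t")
  case False
  with assms have st: "s < t" by simp
  have "prob {\<omega> \<in> space M. 0 \<le> int (N t \<omega>) - int (N s \<omega>)} = 1"
    using measure_increment[OF assms(1) st, of "\<lambda>x. 0 \<le> x"] by simp
  then have "AE \<omega> in M. \<omega> \<in> {\<omega> \<in> space M. 0 \<le> int (N t \<omega>) - int (N s \<omega>)}"
    by (rule AE_in_set_eq_1[THEN iffD2, rotated])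
      (use measurable_increment[OF assms(1) st] in measurable)
  then show ?thesis by eventually_elim auto
qed simp

text \<open>The Poisson mass of {0, 1} is (1 + \<mu>) exp(-\<mu>), and exp(-\<mu>) \<ge> 1 - \<mu>
  leaves at most \<mu>^2 for the complement. The quadratic order makes the total over a fine grid
  vanish.\<close>

lemma prob_increment_ge_2:
  assumes "0 \<le> s" "s < t"
  shows "prob {\<omega> \<in> space M. 2 \<le> int (N t \<omega>) - int (N s \<omega>)} \<le> (rate * (t - s))\<^sup>2"
proof -
  define \<mu> where "\<mu> = rate * (t - s)"
  have pos: "0 < \<mu>" using assms rate_pos by (simp add: \<mu>_def)
  have "prob {\<omega> \<in> space M. 2 \<le> int (N t \<omega>) - int (N s \<omega>)} =
      measure_pmf.prob (poisson_pmf \<mu>) (UNIV - {0, 1})"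
    unfolding measure_increment[OF assms] \<mu>_def by (intro arg_cong2[where f = measure]) auto
  also have "\<dots> = 1 - measure_pmf.prob (poisson_pmf \<mu>) {0, 1}"
    by (subst measure_pmf.prob_compl[symmetric]) auto
  also have "measure_pmf.prob (poisson_pmf \<mu>) {0, 1} = (1 + \<mu>) * exp (- \<mu>)"
    using pos by (subst measure_measure_pmf_finite) (auto simp: algebra_simps)
  also have "1 - (1 + \<mu>) * exp (- \<mu>) \<le> 1 - (1 + \<mu>) * (1 - \<mu>)"
    using pos exp_ge_add_one_self[of "- \<mu>"] by (intro diff_left_mono mult_left_mono) auto
  also have "\<dots> = \<mu>\<^sup>2" by (simp add: algebra_simps power2_eq_square)
  finally show ?thesis by (simp add: \<mu>_def)
qed

text \<open>Paths skip no value: on a grid of mesh \<open>t / n\<close>, an increment of size at least \<open>2\<close> occurs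
  with probability at most \<open>n * (rate * t / n)\<^sup>2\<close>, which tends to \<open>0\<close>.\<close>

lemma AE_intermediate_value:
  assumes "0 \<le> t"
  shows "AE \<omega> in M. m \<le> N t \<omega> \<longrightarrow> (\<exists>s. 0 \<le> s \<and> s \<le> t \<and> N s \<omega> = m)"
proof (cases "t = 0")
  case True
  have "m \<le> N t \<omega> \<longrightarrow> (\<exists>s. 0 \<le> s \<and> s \<le> t \<and> N s \<omega> = m)" if "\<omega> \<in> space M" for \<omega>
    using start_zero[OF that] True by auto
  then show ?thesis by simp
next
  case False
  with assms have t: "0 < t" by simp
  define g where "g n i = t * real i / real (Suc n)" for n i
  have g: "0 \<le> g n i" "g n i < g n (Suc i)" for n i
    using t by (auto simp: g_def divide_strict_right_mono)
  define J where "J n i = {\<omega> \<in> space M. 2 \<le> int (N (g n (Suc i)) \<omega>) - int (N (g n i) \<omega>)}" for n i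
  define B where "B n = (\<Union>i<Suc n. J n i)" for n
  have J[measurable]: "J n i \<in> sets M" for n i
    unfolding J_def using measurable_increment[OF g] by measurable
  have B[measurable]: "B n \<in> sets M" for n unfolding B_def by auto
  have bound: "prob (B n) \<le> (rate * t)\<^sup>2 / real (Suc n)" for n
  proof -
    have "prob (B n) \<le> (\<Sum>i<Suc n. prob (J n i))"
      unfolding B_def by (intro finite_measure_subadditive_finite) auto
    also have "\<dots> \<le> (\<Sum>i<Suc n. (rate * t / real (Suc n))\<^sup>2)"
    proof (rule sum_mono)
      fix i
      have "prob (J n i) \<le> (rate * (g n (Suc i) - g n i))\<^sup>2"
        unfolding J_def by (rule prob_increment_ge_2[OF g])
      also have "g n (Suc i) - g n i = t / real (Suc n)"
        by (simp add: g_def diff_divide_distrib[symmetric] right_diff_distrib[symmetric])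
      finally show "prob (J n i) \<le> (rate * t / real (Suc n))\<^sup>2" by simp
    qed
    also have "\<dots> = (rate * t)\<^sup>2 / real (Suc n)"
      by (simp add: power2_eq_square del: of_nat_Suc)
    finally show ?thesis .
  qed
  \<comment> \<open>The intersection is the event that every grid shows a jump of size at least 2;
    off this null event a single good grid \<open>n\<close> is enough.\<close>
  have "prob (\<Inter>n. B n) \<le> (rate * t)\<^sup>2 / real (Suc n)" for n
    by (rule order_trans[OF finite_measure_mono bound]) auto
  moreover have "(\<lambda>n. (rate * t)\<^sup>2 / real (Suc n)) \<longlonglongrightarrow> 0"
    using LIMSEQ_inverse_real_of_nat[THEN tendsto_mult_left[of _ _ _ "(rate * t)\<^sup>2"]]
    by (simp add: divide_inverse)
  ultimately have "prob (\<Inter>n. B n) \<le> 0"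
    by (intro LIMSEQ_le_const) auto
  then have "prob (\<Inter>n. B n) = 0" using measure_nonneg[of M] by (simp add: antisym)
  then have "AE \<omega> in M. \<omega> \<notin> (\<Inter>n. B n)"
    by (intro AE_not_in) (auto simp: null_sets_def emeasure_eq_measure)
  then show ?thesis using AE_space
  proof eventually_elim
    case (elim \<omega>)
    then obtain n where n: "\<omega> \<notin> B n" by auto
    have step: "N (g n (Suc i)) \<omega> \<le> Suc (N (g n i) \<omega>)" if "i \<le> n" for i
    proof -
      have "\<omega> \<notin> J n i" using n that unfolding B_def by (auto simp: less_Suc_eq_le)
      then show ?thesis using elim(2) by (simp add: J_def)
    qed
    \<comment> \<open>Discrete intermediate value argument: where the grid values pass from below
      \<open>m\<close> to at least \<open>m\<close>, a step of at most 1 lands on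
      \<open>m\<close>.\<close>
    have "\<exists>j\<le>i. N (g n j) \<omega> = m" if "i \<le> Suc n" "m \<le> N (g n i) \<omega>" for i
      using that
    proof (induction i)
      case 0
      then show ?case using start_zero[OF elim(2)] by (simp add: g_def)
    next
      case (Suc i)
      show ?case
      proof (cases "m \<le> N (g n i) \<omega>")
        case True
        with Suc obtain j where "j \<le> i" "N (g n j) \<omega> = m" by auto
        then show ?thesis by (intro exI[of _ j]) auto
      next
        case False
        with Suc step[of i] show ?thesis by (intro exI[of _ "Suc i"]) auto
      qed
    qed
    from this[of "Suc n"] have *: "\<exists>j\<le>Suc n. N (g n j) \<omega> = m" if "m \<le> N t \<omega>"
      using that by (simp add: g_def)
    have "g n j \<le> t" if "j \<le> Suc n" for j
    proof -
      have "real j \<le> real (Suc n)" using that by simp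
      then have "t * real j \<le> t * real (Suc n)" using t by (intro mult_left_mono) auto
      then show ?thesis unfolding g_def by (subst pos_divide_le_eq) auto
    qed
    with * g(1) show ?case by blast
  qed
qed

section \<open>Marginal tails and first-visit probabilities\<close>

text \<open>The Poisson tail is the distribution function of the (n+1)-st arrival time. The
  parameter \<open>n\<close> of \<open>erlang_density\<close> stands for shape n + 1, which matches
  the strict inequality.\<close>

lemma emeasure_N_gt:
  assumes "0 \<le> t"
  shows "emeasure M {\<omega> \<in> space M. n < N t \<omega>} = emeasure (density lborel (erlang_density n rate)) {..t}"
proof (cases "t = 0")
  case True
  have "{\<omega> \<in> space M. n < N t \<omega>} = {}" using start_zero True by auto
  then have "emeasure M {\<omega> \<in> space M. n < N t \<omega>} = 0" by (simp only: emeasure_empty)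
  then show ?thesis
    using True rate_pos by (simp add: emeasure_erlang_density erlang_CDF_at0)
next
  case False
  with assms have t: "0 < t" by simp
  have "prob {\<omega> \<in> space M. n < N t \<omega>} = measure_pmf.prob (poisson_pmf (rate * t)) (UNIV - {..n})"
    unfolding measure_N[OF t] by (intro arg_cong2[where f = measure]) auto
  also have "\<dots> = 1 - measure_pmf.prob (poisson_pmf (rate * t)) {..n}"
    by (subst measure_pmf.prob_compl[symmetric]) auto
  also have "\<dots> = erlang_CDF n rate t"
    using t rate_pos by (subst measure_measure_pmf_finite) (auto simp: erlang_CDF_def)
  finally show ?thesis
    using rate_pos by (simp add: emeasure_erlang_density emeasure_eq_measure)
qed

text \<open>Almost surely the walk is nondecreasing, so if it equals \<open>k\<close> at step n + 1
  but not at step \<open>n\<close>, it was below \<open>k\<close> at all earlier steps. The event is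
  thus a set difference of two events with explicit probabilities.\<close>

lemma prob_first_visit:
  assumes "1 \<le> k"
  shows "prob {\<omega> \<in> space M. N (real (Suc n)) \<omega> = k \<and> (\<forall>i\<le>n. N (real i) \<omega> \<noteq> k)} =
    exp (- (rate * real (Suc n))) * (rate ^ k / fact k) * (real (Suc n) ^ k - real n ^ k)"
proof -
  have [measurable]: "N (real i) \<in> M \<rightarrow>\<^sub>M count_space UNIV" for i
    by (rule measurable_N) simp
  have "AE \<omega> in M. \<forall>i\<in>{..n}. N (real i) \<omega> \<le> N (real n) \<omega>"
    by (intro AE_finite_allI) (auto intro!: AE_mono)
  moreover have "AE \<omega> in M. N (real n) \<omega> \<le> N (real (Suc n)) \<omega>" by (rule AE_mono) auto
  ultimately have "AE \<omega> in M.
     (\<omega> \<in> {\<omega> \<in> space M. N (real (Suc n)) \<omega> = k \<and> (\<forall>i\<le>n. N (real i) \<omega> \<noteq> k)}) =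
     (\<omega> \<in> {\<omega> \<in> space M. N (real (Suc n)) \<omega> = k} - {\<omega> \<in> space M. N (real (Suc n)) \<omega> = k \<and> N (real n) \<omega> = k})"
  proof eventually_elim
    case (elim \<omega>)
    have "N (real i) \<omega> \<noteq> k"
      if "i \<le> n" "N (real (Suc n)) \<omega> = k" "N (real n) \<omega> \<noteq> k" for i
    proof -
      have "N (real i) \<omega> \<le> N (real n) \<omega>" using elim(1) that(1) by simp
      with elim(2) that(2,3) show ?thesis by linarith
    qed
    then show ?case by blast
  qed
  then have "prob {\<omega> \<in> space M. N (real (Suc n)) \<omega> = k \<and> (\<forall>i\<le>n. N (real i) \<omega> \<noteq> k)} =
     prob ({\<omega> \<in> space M. N (real (Suc n)) \<omega> = k} - {\<omega> \<in> space M. N (real (Suc n)) \<omega> = k \<and> N (real n) \<omega> = k})"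
    by (rule measure_eq_AE) measurable
  also have "\<dots> = prob {\<omega> \<in> space M. N (real (Suc n)) \<omega> = k} -
      prob {\<omega> \<in> space M. N (real (Suc n)) \<omega> = k \<and> N (real n) \<omega> = k}"
  proof (rule finite_measure_Diff)
    show "{\<omega> \<in> space M. N (real (Suc n)) \<omega> = k} \<in> sets M" by measurable
    show "{\<omega> \<in> space M. N (real (Suc n)) \<omega> = k \<and> N (real n) \<omega> = k} \<in> sets M" by measurable
  qed auto
  also have "prob {\<omega> \<in> space M. N (real (Suc n)) \<omega> = k} =
      exp (- (rate * real (Suc n))) * (rate ^ k / fact k) * real (Suc n) ^ k"
    using measure_N[of "real (Suc n)" "\<lambda>x. x = k"] rate_pos
    by (simp add: measure_pmf_single power_mult_distrib)
  also have "prob {\<omega> \<in> space M. N (real (Suc n)) \<omega> = k \<and> N (real n) \<omega> = k} =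
      exp (- (rate * real (Suc n))) * (rate ^ k / fact k) * real n ^ k"
  \<comment> \<open>For \<open>n = 0\<close> the times 0, n, n + 1 are not strictly increasing;
    there the event is empty, in agreement with 0^k = 0 for k \<ge> 1.\<close>
  proof (cases "n = 0")
    case True
    have "{\<omega> \<in> space M. N (real (Suc n)) \<omega> = k \<and> N (real n) \<omega> = k} = {}"
      using start_zero True assms by auto
    then have "prob {\<omega> \<in> space M. N (real (Suc n)) \<omega> = k \<and> N (real n) \<omega> = k} = 0"
      by (simp only: measure_empty)
    then show ?thesis using True assms by simp
  next
    case False
    \<comment> \<open>Only the times 0, n, n + 1 enter: the increment \<open>k\<close> up to
      \<open>n\<close> and the increment 0 over the last unit. The latter has probability
      exp(-rate), which completes the exponential.\<close>
    define t where "t i = (if i = 0 then 0 else if i = 1 then real n else real (Suc n))" for i :: nat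
    define D where "D i \<omega> = int (N (t (Suc i)) \<omega>) - int (N (t i) \<omega>)" for i \<omega>
    have "indep_vars (\<lambda>_. count_space UNIV) D {..<2}"
      unfolding D_def by (rule indep_increments) (use False in \<open>auto simp: t_def less_2_cases_iff\<close>)
    then have "prob (\<Inter>i<2. D i -` (if i = 0 then {int k} else {0}) \<inter> space M) =
        (\<Prod>i<2. prob (D i -` (if i = 0 then {int k} else {0}) \<inter> space M))"
      by (rule indep_varsD) (auto simp: lessThan_empty_iff)
    also have "\<dots> = prob (D 0 -` {int k} \<inter> space M) * prob (D 1 -` {0} \<inter> space M)"
      by (simp add: numeral_2_eq_2)
    also have "(\<Inter>i<2. D i -` (if i = 0 then {int k} else {0}) \<inter> space M) =
        {\<omega> \<in> space M. N (real (Suc n)) \<omega> = k \<and> N (real n) \<omega> = k}"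
      using start_zero by (auto simp: D_def t_def numeral_2_eq_2 lessThan_Suc)
    also have "D 0 -` {int k} \<inter> space M = {\<omega> \<in> space M. N (real n) \<omega> = k}"
      using start_zero by (auto simp: D_def t_def)
    also have "prob \<dots> = exp (- (rate * real n)) * (rate ^ k / fact k) * real n ^ k"
      using measure_N[of "real n" "\<lambda>x. x = k"] rate_pos False
      by (simp add: measure_pmf_single power_mult_distrib)
    also have "D 1 -` {0} \<inter> space M =
        {\<omega> \<in> space M. int (N (real (Suc n)) \<omega>) - int (N (real n) \<omega>) = 0}"
      by (auto simp: D_def t_def)
    also have "prob \<dots> = exp (- rate)"
      using measure_increment[of "real n" "real (Suc n)" "\<lambda>x. x = 0"] rate_pos
      by (simp add: measure_pmf_single)
    finally show ?thesis by (simp add: algebra_simps exp_add[symmetric])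
  qed
  finally show ?thesis by (simp only: right_diff_distrib)
qed

end

section \<open>The iterated process and measurability of its hitting time\<close>

locale iterated_poisson =
  A: poisson_process M "\<alpha>" NA + B: poisson_process M "\<beta>" NB
  for M :: "'a measure" and \<alpha> \<beta> :: real and NA NB :: "real \<Rightarrow> 'a \<Rightarrow> nat" +
  fixes k :: nat
  assumes indep: "indep_processes M NA NB"
    and k_pos: "1 \<le> k"
begin

definition T :: "'a \<Rightarrow> ereal" where
  "T = hitting_time (\<lambda>s \<omega>. NA (real (NB s \<omega>)) \<omega>) k"

lemma eventually_constant_iterated:
  assumes "\<omega> \<in> space M" "0 \<le> t"
  shows "eventually (\<lambda>u. NA (real (NB u \<omega>)) \<omega> = NA (real (NB t \<omega>)) \<omega>) (at_right t)"
  using B.eventually_constant[OF assms] by eventually_elim simp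

text \<open>The random time \<open>NB t\<close> takes countably many values, so the composition is
  glued from countably many measurable pieces.\<close>

lemma measurable_iterated:
  assumes "0 \<le> t"
  shows "(\<lambda>\<omega>. NA (real (NB t \<omega>)) \<omega>) \<in> M \<rightarrow>\<^sub>M count_space UNIV"
  by (rule measurable_compose_countable[OF A.measurable_N B.measurable_N]) (use assms in auto)

lemma measurable_T [measurable]: "T \<in> borel_measurable M"
proof (rule borel_measurableI_less)
  fix a
  have "{\<omega> \<in> space M. T \<omega> < a} =
    (\<Union>q\<in>{q\<in>\<rat>. 0 \<le> q \<and> ereal q < a}. {\<omega> \<in> space M. NA (real (NB q \<omega>)) \<omega> = k})"
    unfolding T_def
    using hitting_time_less_iff[of "\<lambda>s \<omega>. NA (real (NB s \<omega>)) \<omega>", OF eventually_constant_iterated]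
    by auto
  also have "\<dots> \<in> sets M"
  proof (rule sets.countable_UN'')
    show "countable {q\<in>\<rat>. 0 \<le> q \<and> ereal q < a}"
      by (rule countable_subset[OF _ countable_rat]) auto
    show "{\<omega> \<in> space M. NA (real (NB q \<omega>)) \<omega> = k} \<in> sets M"
      if "q \<in> {q\<in>\<rat>. 0 \<le> q \<and> ereal q < a}" for q
      using measurable_iterated[of q] that by simp
  qed
  finally show "{\<omega> \<in> space M. T \<omega> < a} \<in> sets M" .
qed

section \<open>Reduction to the walk at integer times\<close>

text \<open>The index is shifted: the visit happens at step n + 1, so that \<open>n\<close> agrees
  with the Erlang parameter and with the condition \<open>n < NB t\<close>.\<close>

definition first_visit :: "nat \<Rightarrow> 'a set" where
  "first_visit n = {\<omega> \<in> space M. NA (real (Suc n)) \<omega> = k \<and> (\<forall>i\<le>n. NA (real i) \<omega> \<noteq> k)}"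

lemma ex_visit_iff:
  assumes "\<omega> \<in> space M"
  shows "(\<exists>i\<le>m. NA (real i) \<omega> = k) \<longleftrightarrow> (\<exists>n<m. \<omega> \<in> first_visit n)"
proof
  assume "\<exists>i\<le>m. NA (real i) \<omega> = k"
  then obtain i where i: "i \<le> m" "NA (real i) \<omega> = k" by auto
  define l where "l = (LEAST i. NA (real i) \<omega> = k)"
  have l: "NA (real l) \<omega> = k" "l \<le> i" "\<And>j. j < l \<Longrightarrow> NA (real j) \<omega> \<noteq> k"
    unfolding l_def using i(2) by (auto intro: LeastI Least_le dest: not_less_Least)
  \<comment> \<open>The walk starts at 0 and k \<ge> 1, so the least visiting step is a
    successor.\<close>
  have "l \<noteq> 0" using l(1) A.start_zero[OF assms] k_pos by (intro notI) simp
  then obtain n where "l = Suc n" by (cases l) auto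
  with l i assms show "\<exists>n<m. \<omega> \<in> first_visit n"
    by (intro exI[of _ n]) (auto simp: first_visit_def)
next
  assume "\<exists>n<m. \<omega> \<in> first_visit n"
  then obtain n where "n < m" "\<omega> \<in> first_visit n" by auto
  then show "\<exists>i\<le>m. NA (real i) \<omega> = k"
    by (intro exI[of _ "Suc n"]) (auto simp: first_visit_def)
qed

text \<open>Monotonicity of \<open>NB\<close> bounds by \<open>NB t\<close> the step at which a hit
  occurs; conversely \<open>NB\<close> skips no value, so each step up to \<open>NB t\<close> is
  reached by time \<open>t\<close>. Monotonicity is asked only at rational times, where countably
  many null sets can be joined.\<close>

lemma AE_T_le_iff:
  assumes t: "0 \<le> t"
  shows "AE \<omega> in M. T \<omega> \<le> ereal t \<longleftrightarrow> (\<exists>n < NB t \<omega>. \<omega> \<in> first_visit n)"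
proof -
  have "AE \<omega> in M. \<forall>q\<in>{q\<in>\<rat>. 0 \<le> q \<and> q < t}. NB q \<omega> \<le> NB t \<omega>"
    by (subst AE_ball_countable, rule countable_subset[OF _ countable_rat])
      (auto intro!: B.AE_mono)
  moreover have "AE \<omega> in M. \<forall>m. m \<le> NB t \<omega> \<longrightarrow> (\<exists>s. 0 \<le> s \<and> s \<le> t \<and> NB s \<omega> = m)"
    unfolding AE_all_countable using B.AE_intermediate_value[OF t] by blast
  ultimately show ?thesis using AE_space
  proof eventually_elim
    case (elim \<omega>)
    have "T \<omega> \<le> ereal t \<longleftrightarrow> (\<exists>i\<le>NB t \<omega>. NA (real i) \<omega> = k)"
    proof
      assume "T \<omega> \<le> ereal t"
      then show "\<exists>i\<le>NB t \<omega>. NA (real i) \<omega> = k"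
        unfolding T_def using elim(1)
          hitting_time_le_iff[of "\<lambda>s \<omega>. NA (real (NB s \<omega>)) \<omega>", OF eventually_constant_iterated[OF elim(3)] t]
        by auto
    next
      assume "\<exists>i\<le>NB t \<omega>. NA (real i) \<omega> = k"
      then obtain s where s: "0 \<le> s" "s \<le> t" "NA (real (NB s \<omega>)) \<omega> = k"
        using elim(2) by metis
      then have "T \<omega> \<le> ereal s"
        unfolding T_def hitting_time_def by (intro Inf_lower) auto
      also have "\<dots> \<le> ereal t" using s by simp
      finally show "T \<omega> \<le> ereal t" .
    qed
    then show ?case using ex_visit_iff[OF elim(3)] by simp
  qed
qed

text \<open>The two events are preimages of the cylinder sets \<open>FA\<close> and
  \<open>FB\<close> under the paths of \<open>NA\<close> and \<open>NB\<close>, so independence of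
  the paths gives the product.\<close>

lemma emeasure_first_visit_Int:
  assumes t: "0 \<le> t"
  shows "first_visit n \<inter> {\<omega> \<in> space M. n < NB t \<omega>} \<in> sets M"
    and "emeasure M (first_visit n \<inter> {\<omega> \<in> space M. n < NB t \<omega>}) =
      emeasure M (first_visit n) * emeasure M {\<omega> \<in> space M. n < NB t \<omega>}"
proof -
  define P :: "(real \<Rightarrow> nat) measure" where "P = Pi\<^sub>M {0..} (\<lambda>_. count_space UNIV)"
  define XA where "XA \<omega> = (\<lambda>t\<in>{0..}. NA t \<omega>)" for \<omega>
  define XB where "XB \<omega> = (\<lambda>t\<in>{0..}. NB t \<omega>)" for \<omega>
  define FA where "FA = {x \<in> space P. x (real (Suc n)) = k \<and> (\<forall>i\<le>n. x (real i) \<noteq> k)}"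
  define FB where "FB = {x \<in> space P. n < x t}"
  have ind: "A.indep_var P XA P XB"
    using indep unfolding indep_processes_def P_def XA_def XB_def .
  have [measurable]: "(\<lambda>x. x s) \<in> P \<rightarrow>\<^sub>M count_space UNIV" if "0 \<le> s" for s
    unfolding P_def using that by (intro measurable_component_singleton) auto
  have F: "FA \<in> sets P" "FB \<in> sets P"
    unfolding FA_def FB_def using t by measurable
  have [measurable]: "XA \<in> M \<rightarrow>\<^sub>M P" "XB \<in> M \<rightarrow>\<^sub>M P"
    using A.indep_var_rv1[OF ind] A.indep_var_rv2[OF ind] by auto
  have XA: "XA -` FA \<inter> space M = first_visit n"
    unfolding FA_def first_visit_def XA_def by (auto simp: P_def space_PiM)
  have XB: "XB -` FB \<inter> space M = {\<omega> \<in> space M. n < NB t \<omega>}"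
    unfolding FB_def XB_def using t by (auto simp: P_def space_PiM)
  have "(\<lambda>\<omega>. (XA \<omega>, XB \<omega>)) -` (FA \<times> FB) \<inter> space M =
      first_visit n \<inter> {\<omega> \<in> space M. n < NB t \<omega>}"
    unfolding XA[symmetric] XB[symmetric] by auto
  with A.indep_varD[OF ind F] XA XB
  show "emeasure M (first_visit n \<inter> {\<omega> \<in> space M. n < NB t \<omega>}) =
      emeasure M (first_visit n) * emeasure M {\<omega> \<in> space M. n < NB t \<omega>}"
    by (simp add: A.emeasure_eq_measure ennreal_mult)
  show "first_visit n \<inter> {\<omega> \<in> space M. n < NB t \<omega>} \<in> sets M"
    unfolding XA[symmetric] XB[symmetric] using F by auto
qed

section \<open>The law of \<open>T\<close> as a mixture of Erlang laws\<close>

text \<open>The weights sum to the probability that the walk ever visits \<open>k\<close>, so the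
  total mass can be below 1.\<close>

definition law :: "real measure" where
  "law = density lborel (\<lambda>s. \<Sum>n. emeasure M (first_visit n) * ennreal (erlang_density n \<beta> s))"

lemma emeasure_law_atMost:
  "emeasure law {..t} =
    (\<Sum>n. emeasure M (first_visit n) * emeasure (density lborel (erlang_density n \<beta>)) {..t})"
  unfolding law_def
  by (simp add: emeasure_density nn_integral_suminf nn_integral_cmult mult.assoc
    flip: ennreal_suminf_multc)

lemma emeasure_T_le: "emeasure M {\<omega> \<in> space M. T \<omega> \<le> ereal t} = emeasure law {..t}"
proof (cases "0 \<le> t")
  case True
  define G where "G n = first_visit n \<inter> {\<omega> \<in> space M. n < NB t \<omega>}" for n
  have G: "G n \<in> sets M" for n
    unfolding G_def by (rule emeasure_first_visit_Int[OF True])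
  have "disjoint_family G"
    unfolding disjoint_family_on_def
  proof (intro ballI impI)
    fix m n :: nat
    assume "m \<noteq> n"
    \<comment> \<open>A first visit at step j + 1 forbids a visit at step i + 1 \<le> j.\<close>
    moreover have False if "i < j" "\<omega> \<in> G i" "\<omega> \<in> G j" for i j \<omega>
      using that Suc_leI[OF that(1)] unfolding G_def first_visit_def by blast
    ultimately show "G m \<inter> G n = {}" by (metis disjoint_iff nat_neq_iff)
  qed
  have "emeasure M {\<omega> \<in> space M. T \<omega> \<le> ereal t} = emeasure M (\<Union>n. G n)"
  proof (rule emeasure_eq_AE)
    show "AE \<omega> in M. \<omega> \<in> {\<omega> \<in> space M. T \<omega> \<le> ereal t} \<longleftrightarrow> \<omega> \<in> (\<Union>n. G n)"
      using AE_T_le_iff[OF True] AE_space by eventually_elim (auto simp: G_def)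
  qed (use G in auto)
  also have "\<dots> = (\<Sum>n. emeasure M (G n))"
    using G \<open>disjoint_family G\<close> by (intro suminf_emeasure[symmetric]) auto
  also have "\<dots> = emeasure law {..t}"
    unfolding G_def emeasure_law_atMost emeasure_first_visit_Int(2)[OF True] B.emeasure_N_gt[OF True] ..
  finally show ?thesis .
next
  case False
  \<comment> \<open>For negative \<open>t\<close> both sides vanish: \<open>T\<close> is nonnegative
    and the Erlang distribution function is 0 there.\<close>
  have "ereal t < T \<omega>" for \<omega>
    using False unfolding T_def by (intro less_le_trans[OF _ hitting_time_nonneg]) simp
  then have "{\<omega> \<in> space M. T \<omega> \<le> ereal t} = {}" by (simp add: not_le[symmetric])
  then have "emeasure M {\<omega> \<in> space M. T \<omega> \<le> ereal t} = 0" by (simp only: emeasure_empty)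
  moreover have "emeasure law {..t} = 0"
    using False B.rate_pos by (simp add: emeasure_law_atMost emeasure_erlang_density erlang_CDF_def)
  ultimately show ?thesis by simp
qed

lemma emeasure_T_in:
  assumes A: "A \<in> sets (borel :: real measure)"
  shows "emeasure M {\<omega> \<in> space M. T \<omega> \<in> ereal ` A} = emeasure law A"
proof -
  \<comment> \<open>Restriction to finite \<open>T\<close> comes first because
    \<open>real_of_ereal\<close> sends \<infinity> to 0, which would otherwise put the defect of the
    law at 0.\<close>
  define \<mu> where "\<mu> = distr (density M (indicator {\<omega> \<in> space M. \<bar>T \<omega>\<bar> \<noteq> \<infinity>})) borel (\<lambda>\<omega>. real_of_ereal (T \<omega>))"
  have \<mu>: "emeasure \<mu> A = emeasure M {\<omega> \<in> space M. T \<omega> \<in> ereal ` A}" if [measurable]: "A \<in> sets borel" for A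
  proof -
    have eq: "(\<lambda>\<omega>. real_of_ereal (T \<omega>)) -` A \<inter> space M \<inter> {\<omega> \<in> space M. \<bar>T \<omega>\<bar> \<noteq> \<infinity>} =
        {\<omega> \<in> space M. T \<omega> \<in> ereal ` A}"
      by (auto simp: image_iff ereal_real)
    have "emeasure \<mu> A = emeasure (density M (indicator {\<omega> \<in> space M. \<bar>T \<omega>\<bar> \<noteq> \<infinity>}))
        ((\<lambda>\<omega>. real_of_ereal (T \<omega>)) -` A \<inter> space M)"
      unfolding \<mu>_def by (subst emeasure_distr) auto
    also have "\<dots> = emeasure M ({\<omega> \<in> space M. \<bar>T \<omega>\<bar> \<noteq> \<infinity>} \<inter> ((\<lambda>\<omega>. real_of_ereal (T \<omega>)) -` A \<inter> space M))"
      by (rule emeasure_restricted) measurable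
    finally show ?thesis using eq by (simp add: Int_commute)
  qed
  \<comment> \<open>The half-lines form an intersection-stable generator of the Borel sets, and
    those ending at natural numbers exhaust the line with finite mass.\<close>
  have "\<mu> = law"
  proof (rule measure_eqI_generator_eq[where E = "range atMost" and \<Omega> = UNIV and A = "\<lambda>n. {..real n}"])
    show "Int_stable (range atMost :: real set set)"
      by (auto simp: Int_stable_def)
    show "sets \<mu> = sigma_sets UNIV (range atMost)" "sets law = sigma_sets UNIV (range atMost)"
      by (simp_all add: \<mu>_def law_def borel_eq_atMost)
    show "emeasure \<mu> X = emeasure law X" if "X \<in> range atMost" for X
    proof -
      obtain t where X: "X = {..t}" using \<open>X \<in> range atMost\<close> by auto
      have "T \<omega> \<in> ereal ` {..t} \<longleftrightarrow> T \<omega> \<le> ereal t" for \<omega>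
        using hitting_time_nonneg[of _ k \<omega>] unfolding T_def
        by (cases "hitting_time (\<lambda>s \<omega>. NA (real (NB s \<omega>)) \<omega>) k \<omega>") (auto simp: image_iff)
      then show ?thesis using emeasure_T_le[of t] by (simp add: X \<mu>)
    qed
    show "(\<Union>i. {..real i}) = UNIV"
      using real_arch_simple by auto
    show "emeasure \<mu> {..real i} \<noteq> \<infinity>" for i
      by (simp add: \<mu> A.emeasure_eq_measure)
  qed auto
  with \<mu>[OF A] show ?thesis by simp
qed

section \<open>Closed form of the density\<close>

text \<open>The series agree term by term: one factor exp(-\<alpha>) splits off the first-visit
  probability and one factor \<beta> off the Erlang density.\<close>

lemma density_eq:
  assumes s: "0 < s"
  shows "(\<Sum>n. emeasure M (first_visit n) * ennreal (erlang_density n \<beta> s)) =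
    ennreal (\<beta> * exp (- \<alpha>) * (\<alpha> ^ k / fact k) * exp (- \<beta> * s) *
      (\<Sum>j. exp (- \<alpha> * real j) * ((real j + 1) ^ k - real j ^ k) * ((\<beta> * s) ^ j / fact j)))"
proof -
  define c where "c = \<beta> * exp (- \<alpha>) * (\<alpha> ^ k / fact k) * exp (- \<beta> * s)"
  define a where "a j = exp (- \<alpha> * real j) * ((real j + 1) ^ k - real j ^ k) * ((\<beta> * s) ^ j / fact j)" for j
  have c: "0 < c" using A.rate_pos B.rate_pos by (simp add: c_def)
  have eq: "A.prob (first_visit n) * erlang_density n \<beta> s = c * a n" for n
  proof -
    have "exp (- (\<alpha> * real (Suc n))) = exp (- \<alpha>) * exp (- \<alpha> * real n)"
      by (simp add: exp_add[symmetric] algebra_simps)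
    then show ?thesis
      unfolding first_visit_def A.prob_first_visit[OF k_pos] erlang_density_def c_def a_def
      using s by (simp add: power_mult_distrib add.commute)
  qed
  have nonneg: "0 \<le> c * a n" for n
    unfolding eq[symmetric] using B.rate_pos by simp
  \<comment> \<open>Bounding each first-visit probability by 1 leaves an exponential series.
    Summability lets the extended nonnegative sum be read as a real one.\<close>
  have "summable (\<lambda>n. c * a n)"
  proof (rule summable_comparison_test)
    show "\<exists>N. \<forall>n\<ge>N. norm (c * a n) \<le> \<beta> * exp (- \<beta> * s) * ((\<beta> * s) ^ n /\<^sub>R fact n)"
    proof (intro exI allI impI)
      fix n
      have "norm (c * a n) = A.prob (first_visit n) * erlang_density n \<beta> s"
        using nonneg[of n] eq[of n] by simp
      also have "\<dots> \<le> 1 * erlang_density n \<beta> s"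
        using B.rate_pos by (intro mult_right_mono) auto
      also have "\<dots> = \<beta> * exp (- \<beta> * s) * ((\<beta> * s) ^ n /\<^sub>R fact n)"
        using s by (simp add: erlang_density_def power_mult_distrib divide_inverse)
      finally show "norm (c * a n) \<le> \<beta> * exp (- \<beta> * s) * ((\<beta> * s) ^ n /\<^sub>R fact n)" .
    qed
    show "summable (\<lambda>n. \<beta> * exp (- \<beta> * s) * ((\<beta> * s) ^ n /\<^sub>R fact n))"
      by (intro summable_mult summable_exp_generic)
  qed
  moreover from this have "summable a" using c by (simp add: summable_mult_D)
  ultimately have "(\<Sum>n. ennreal (c * a n)) = ennreal (c * (\<Sum>n. a n))"
    using nonneg by (simp add: suminf_ennreal2 suminf_mult)
  moreover have "emeasure M (first_visit n) * ennreal (erlang_density n \<beta> s) = ennreal (c * a n)" for n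
    using B.rate_pos by (simp add: A.emeasure_eq_measure ennreal_mult'' flip: eq)
  ultimately show ?thesis by (simp add: c_def a_def)
qed

end

theorem theorem2p3:
  fixes M :: "'a measure"
    and N\<^sub>\<alpha> N\<^sub>\<beta> :: "real \<Rightarrow> 'a \<Rightarrow> nat"
    and rate\<^sub>\<alpha> rate\<^sub>\<beta> :: real
    and k :: nat
  assumes "0 < rate\<^sub>\<alpha>" and "0 < rate\<^sub>\<beta>"
    and "poisson_process M rate\<^sub>\<alpha> N\<^sub>\<alpha>"
    and "poisson_process M rate\<^sub>\<beta> N\<^sub>\<beta>"
    and "indep_processes M N\<^sub>\<alpha> N\<^sub>\<beta>"
    and "1 \<le> k"
  shows "let T = hitting_time (\<lambda>s \<omega>. N\<^sub>\<alpha> (real (N\<^sub>\<beta> s \<omega>)) \<omega>) k in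
    T \<in> borel_measurable M \<and>
    (\<forall>A \<in> sets (borel :: real measure). A \<subseteq> {0<..} \<longrightarrow>
      emeasure M {\<omega> \<in> space M. T \<omega> \<in> ereal ` A} =
      (\<integral>\<^sup>+ s \<in> A. ennreal (rate\<^sub>\<beta> * exp (- rate\<^sub>\<alpha>) * (rate\<^sub>\<alpha> ^ k / fact k) * exp (- rate\<^sub>\<beta> * s) *
         (\<Sum>j. exp (- rate\<^sub>\<alpha> * real j) * ((real j + 1) ^ k - real j ^ k) *
               ((rate\<^sub>\<beta> * s) ^ j / fact j))) \<partial>lborel))"
proof -
  interpret \<alpha>: poisson_process M rate\<^sub>\<alpha> N\<^sub>\<alpha> by fact
  interpret \<beta>: poisson_process M rate\<^sub>\<beta> N\<^sub>\<beta> by fact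
  interpret iterated_poisson M rate\<^sub>\<alpha> rate\<^sub>\<beta> N\<^sub>\<alpha> N\<^sub>\<beta> k
    by unfold_locales fact+
  have "emeasure M {\<omega> \<in> space M. T \<omega> \<in> ereal ` A} =
      (\<integral>\<^sup>+ s \<in> A. ennreal (rate\<^sub>\<beta> * exp (- rate\<^sub>\<alpha>) * (rate\<^sub>\<alpha> ^ k / fact k) * exp (- rate\<^sub>\<beta> * s) *
         (\<Sum>j. exp (- rate\<^sub>\<alpha> * real j) * ((real j + 1) ^ k - real j ^ k) *
               ((rate\<^sub>\<beta> * s) ^ j / fact j))) \<partial>lborel)"
    if A: "A \<in> sets borel" "A \<subseteq> {0<..}" for A
  proof -
    have "emeasure M {\<omega> \<in> space M. T \<omega> \<in> ereal ` A} =
        (\<integral>\<^sup>+ s \<in> A. (\<Sum>n. emeasure M (first_visit n) * ennreal (erlang_density n rate\<^sub>\<beta> s)) \<partial>lborel)"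
      unfolding emeasure_T_in[OF A(1)] law_def using A(1) by (simp add: emeasure_density)
    also have "\<dots> = (\<integral>\<^sup>+ s \<in> A. ennreal (rate\<^sub>\<beta> * exp (- rate\<^sub>\<alpha>) * (rate\<^sub>\<alpha> ^ k / fact k) * exp (- rate\<^sub>\<beta> * s) *
         (\<Sum>j. exp (- rate\<^sub>\<alpha> * real j) * ((real j + 1) ^ k - real j ^ k) *
               ((rate\<^sub>\<beta> * s) ^ j / fact j))) \<partial>lborel)"
    proof (rule nn_integral_cong)
      \<comment> \<open>Off \<open>A\<close> both integrands are 0; on \<open>A\<close> the time
        \<open>s\<close> is positive, as the closed form requires.\<close>
      fix s :: real
      show "(\<Sum>n. emeasure M (first_visit n) * ennreal (erlang_density n rate\<^sub>\<beta> s)) * indicator A s =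
        ennreal (rate\<^sub>\<beta> * exp (- rate\<^sub>\<alpha>) * (rate\<^sub>\<alpha> ^ k / fact k) * exp (- rate\<^sub>\<beta> * s) *
         (\<Sum>j. exp (- rate\<^sub>\<alpha> * real j) * ((real j + 1) ^ k - real j ^ k) *
               ((rate\<^sub>\<beta> * s) ^ j / fact j))) * indicator A s"
        using density_eq[of s] A(2) by (cases "s \<in> A") auto
    qed
    finally show ?thesis .
  qed
  with measurable_T show ?thesis unfolding Let_def T_def[symmetric] by blast
qed

end
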